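(* For any finite non-bipartite colorful graph $G$, $\theta(G)=1$.
   Context: A graph $G$ with chromatic number $k$ is colorful if for every proper $k$-coloring $c$ of $G$ there is an induced subgraph $H$ of $G$ such that for every vertex $v$ of $H$, $c(N[v])=\{1,\ldots,k\}$, where $N[v]$ is the closed neighborhood of $v$ in $G$. For a positive integer $t$, $G^{t}$ has vertex set $V(G)$, with $u,v$ adjacent iff there is a walk of length $t$ between them in $G$. $S_t(G)$ replaces each edge by a path with exactly $t-1$ inner vertices, and $G^{\frac{2r+1}{2s+1}}:=(S_{2s+1}(G))^{2r+1}$ for non-negative integers $r,s$. $og(G)$ is the odd girth. For a non-bipartite graph $G$, $\theta(G):=\sup\{\frac{2r+1}{2s+1}: r,s\ge 0 \text{ integers},\ \chi(G^{\frac{2r+1}{2s+1}})\le\chi(G),\ \frac{2r+1}{2s+1}<og(G)\}$.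
   Formalization: In the definition of colorful, N[v] is the closed neighborhood of v in the nonempty induced subgraph H rather than in G; with N[v] in G every nonempty graph would be colorful and the claim fails for C_5, where θ(C_5) ≥ 5/3. *)

theory Defs
  imports
    "Graph_Theory.Graph_Theory"
    "HOL-Library.Extended_Nat"
    "HOL-Library.Extended_Real"
begin

text \<open>
  Graphs are symmetric pair digraphs. A finite simple graph is a \<^const>\<open>pair_graph\<close>;
  powers of graphs may carry loops and are then only pair pseudo graphs.
\<close>

definition proper_coloring :: "'a pair_pre_digraph \<Rightarrow> nat \<Rightarrow> ('a \<Rightarrow> nat) \<Rightarrow> bool" where
  "proper_coloring G k c \<longleftrightarrow>
     c ` pverts G \<subseteq> {1..k} \<and> (\<forall>(u, v) \<in> parcs G. c u \<noteq> c v)"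

text \<open>The value is \<open>\<infinity>\<close> when there is no finite proper coloring, e.g. in the presence of loops.\<close>

definition chromatic_number :: "'a pair_pre_digraph \<Rightarrow> enat" where
  "chromatic_number G = Inf {enat k | k. \<exists>c. proper_coloring G k c}"

definition bipartite :: "'a pair_pre_digraph \<Rightarrow> bool" where
  "bipartite G \<longleftrightarrow>
     (\<exists>X Y. pverts G = X \<union> Y \<and> X \<inter> Y = {} \<and> parcs G \<subseteq> X \<times> Y \<union> Y \<times> X)"

text \<open>
  \<^const>\<open>pre_digraph.cycle\<close> also admits the closed walk \<open>u, v, u\<close> along a single edge,
  but that one has even length.
\<close>

definition odd_girth :: "'a pair_pre_digraph \<Rightarrow> enat" where
  "odd_girth G = Inf {enat (length p) | p. pre_digraph.cycle (with_proj G) p \<and> odd (length p)}"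

definition closed_neighborhood :: "'a pair_pre_digraph \<Rightarrow> 'a \<Rightarrow> 'a set" where
  "closed_neighborhood G v = insert v {w. (v, w) \<in> parcs G}"

text \<open>
  The subgraph \<open>H\<close> is nonempty and the closed neighborhoods are those of \<open>H\<close>.
  With closed neighborhoods taken in \<open>G\<close> the condition would hold for every nonempty finite
  graph: in a coloring with \<open>\<chi>(G)\<close> colors each color class contains a vertex that sees
  all other colors (otherwise the class could be recolored away), and \<open>H\<close> could be that single
  vertex.
\<close>

definition colorful :: "'a pair_pre_digraph \<Rightarrow> bool" where
  "colorful G \<longleftrightarrow>
     (\<exists>k. chromatic_number G = enat k \<and>
       (\<forall>c. proper_coloring G k c \<longrightarrow>
         (\<exists>H. induced_subgraph (with_proj H) (with_proj G) \<and> pverts H \<noteq> {} \<and>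
           (\<forall>v \<in> pverts H. c ` closed_neighborhood H v = {1..k}))))"

definition graph_power :: "'a pair_pre_digraph \<Rightarrow> nat \<Rightarrow> 'a pair_pre_digraph" where
  "graph_power G t =
     \<lparr> pverts = pverts G,
       parcs = {(u, v). \<exists>p. pre_digraph.awalk (with_proj G) u p v \<and> length p = t} \<rparr>"

text \<open>
  The vertices of the subdivision \<open>S\<^sub>t(G)\<close> are represented by barycentric coordinates scaled by
  \<open>t\<close>: the vertex at distance \<open>i\<close> from \<open>u\<close> on the path replacing the edge \<open>uv\<close> has weight
  \<open>t - i\<close> at \<open>u\<close> and \<open>i\<close> at \<open>v\<close>. An original vertex \<open>u\<close> has weight \<open>t\<close> at \<open>u\<close>. The two
  orientations of an edge thus give the same path.
\<close>

definition subdiv_vertex :: "nat \<Rightarrow> 'a \<Rightarrow> 'a \<Rightarrow> nat \<Rightarrow> ('a \<Rightarrow> nat)" where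
  "subdiv_vertex t u v i = (\<lambda>x. (if x = u then t - i else 0) + (if x = v then i else 0))"

lemma subdiv_vertex_swap:
  "i \<le> t \<Longrightarrow> subdiv_vertex t v u (t - i) = subdiv_vertex t u v i"
  by (auto simp: subdiv_vertex_def fun_eq_iff)

lemma subdiv_vertex_inner_eq_iff:
  assumes "u \<noteq> v" "u' \<noteq> v'" "0 < i" "i < t" "0 < j" "j < t"
  shows "subdiv_vertex t u v i = subdiv_vertex t u' v' j \<longleftrightarrow>
           (u = u' \<and> v = v' \<and> i = j) \<or> (u = v' \<and> v = u' \<and> i = t - j)"
proof
  assume eq: "subdiv_vertex t u v i = subdiv_vertex t u' v' j"
  show "(u = u' \<and> v = v' \<and> i = j) \<or> (u = v' \<and> v = u' \<and> i = t - j)"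
    using assms fun_cong[OF eq, of u] fun_cong[OF eq, of v]
    by (auto simp: subdiv_vertex_def split: if_splits)
qed (use assms in \<open>auto simp: subdiv_vertex_def fun_eq_iff\<close>)

definition subdivide_edges :: "nat \<Rightarrow> 'a pair_pre_digraph \<Rightarrow> ('a \<Rightarrow> nat) pair_pre_digraph" where
  "subdivide_edges t G =
     \<lparr> pverts = {subdiv_vertex t u u 0 | u. u \<in> pverts G} \<union>
         {subdiv_vertex t u v i | u v i. (u, v) \<in> parcs G \<and> 0 < i \<and> i < t},
       parcs = {(subdiv_vertex t u v i, subdiv_vertex t u v j) | u v i j.
         (u, v) \<in> parcs G \<and> i \<le> t \<and> j \<le> t \<and> (j = Suc i \<or> i = Suc j)} \<rparr>"

definition fractional_power ::
    "'a pair_pre_digraph \<Rightarrow> nat \<Rightarrow> nat \<Rightarrow> ('a \<Rightarrow> nat) pair_pre_digraph" where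
  "fractional_power G r s = graph_power (subdivide_edges (2 * s + 1) G) (2 * r + 1)"

definition theta :: "'a pair_pre_digraph \<Rightarrow> real" where
  "theta G = Sup {real (2 * r + 1) / real (2 * s + 1) | r s.
     chromatic_number (fractional_power G r s) \<le> chromatic_number G \<and>
     ereal (real (2 * r + 1) / real (2 * s + 1)) < ereal_of_enat (odd_girth G)}"

end

theory Submission
  imports Defs
begin

text \<open>
  Let \<open>t = 2s + 1\<close> and let \<open>c\<close> be a \<open>\<chi>(G)\<close>-coloring of \<open>S\<^sub>t(G)\<^bsup>2r+1\<^esup>\<close> with \<open>r > s\<close>. Walks can be
  lengthened by two, so \<open>c\<close> separates the ends of every walk of length \<open>t\<close> or \<open>t + 2\<close>; in particular
  it restricts to a proper coloring of \<open>G\<close>. Take \<open>H\<close> from colorfulness. On every edge \<open>vw\<close> of \<open>H\<close>,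
  all vertices at even distance \<open>i < t\<close> from \<open>v\<close> have the color of \<open>v\<close>: inductively, the vertex at
  distance \<open>i + 2\<close> is joined by a walk of length \<open>t + 2\<close> through \<open>v\<close> to the vertex at distance \<open>i\<close>
  from \<open>u\<close> on \<open>uv\<close>, for every neighbor \<open>u\<close> of \<open>v\<close>, so it avoids the colors of all neighbors of \<open>v\<close>.
  For \<open>i = t - 1\<close> this means that the vertices next to \<open>w\<close> carry the colors of the neighbors of
  \<open>w\<close>. Comparing these with the vertices next to \<open>v\<close> shows that all neighbors of \<open>w\<close> have
  the color of \<open>v\<close>. Hence \<open>w\<close> sees only two colors, so \<open>\<chi>(G) \<le> 2\<close> and \<open>G\<close> is bipartite.
\<close>

section \<open>Colorings\<close>

text \<open>A nonempty infimum in \<open>enat\<close> is attained, and a coloring with fewer colors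
  is also one with \<open>k\<close> colors.\<close>

lemma chromatic_number_le_iff:
  "chromatic_number G \<le> enat k \<longleftrightarrow> (\<exists>c. proper_coloring G k c)"
proof
  let ?S = "{enat k | k. \<exists>c. proper_coloring G k c}"
  assume le: "chromatic_number G \<le> enat k"
  then have "?S \<noteq> {}"
    unfolding chromatic_number_def by (auto simp: Inf_enat_def split: if_splits)
  then have "Inf ?S \<in> ?S"
    unfolding Inf_enat_def by (metis (no_types, lifting) LeastI ex_in_conv)
  then obtain j c where j: "Inf ?S = enat j" and c: "proper_coloring G j c"
    by blast
  from le j have "j \<le> k"
    unfolding chromatic_number_def by simp
  with c have "proper_coloring G k c"
    unfolding proper_coloring_def by fastforce
  then show "\<exists>c. proper_coloring G k c"
    by blast
next
  assume "\<exists>c. proper_coloring G k c"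
  then show "chromatic_number G \<le> enat k"
    unfolding chromatic_number_def by (blast intro: Inf_lower)
qed

lemma bipartite_if_proper_coloring_le_2:
  assumes "pair_graph G" "proper_coloring G k c" "k \<le> 2"
  shows "bipartite G"
proof -
  interpret pair_graph G by fact
  have col: "c v = 1 \<or> c v = 2" if "v \<in> pverts G" for v
  proof -
    have "c v \<in> {1..k}" using assms(2) that unfolding proper_coloring_def by blast
    then show ?thesis using \<open>k \<le> 2\<close> by auto
  qed
  let ?X = "{v \<in> pverts G. c v = 1}" and ?Y = "{v \<in> pverts G. c v = 2}"
  have "parcs G \<subseteq> ?X \<times> ?Y \<union> ?Y \<times> ?X"
  proof
    fix e assume e: "e \<in> parcs G"
    obtain u v where uv: "e = (u, v)" by (cases e)
    have "u \<in> pverts G" "v \<in> pverts G"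
      using e uv in_arcsD1 in_arcsD2 by blast+
    moreover have "c u \<noteq> c v"
      using assms(2) e uv unfolding proper_coloring_def by blast
    ultimately show "e \<in> ?X \<times> ?Y \<union> ?Y \<times> ?X"
      using col[of u] col[of v] uv by auto
  qed
  moreover have "pverts G = ?X \<union> ?Y" "?X \<inter> ?Y = {}"
    using col by auto
  ultimately show ?thesis
    unfolding bipartite_def by blast
qed

text \<open>A cycle of length one would be a loop. The bound makes the exponent 1 admissible in
  \<open>theta\<close>.\<close>

lemma odd_girth_ge_2:
  assumes "pair_graph G"
  shows "2 \<le> odd_girth G"
proof -
  interpret pair_graph G by fact
  have "2 \<le> length p" if p: "pre_digraph.cycle (with_proj G) p" for p
  proof (rule ccontr)
    assume "\<not> 2 \<le> length p"
    with p obtain e where e: "p = [e]"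
      unfolding pre_digraph.cycle_def by (cases p) (auto simp: Suc_le_eq)
    with p have "e \<in> parcs G" "fst e = snd e"
      by (auto simp: pre_digraph.cycle_def pre_digraph.awalk_def pre_digraph.cas.simps)
    then show False
      using no_loops by auto
  qed
  then show ?thesis
    unfolding odd_girth_def
    by (intro Inf_greatest) (auto simp flip: numeral_eq_enat)
qed

section \<open>Walks\<close>

text \<open>Relational powers are easier to concatenate and reverse than arc lists. The zeroth power
  is the identity on the whole type, hence the explicit membership of \<open>u\<close>.\<close>

lemma ex_awalk_iff_relpow:
  assumes "parcs G \<subseteq> pverts G \<times> pverts G"
  shows "(\<exists>p. pre_digraph.awalk (with_proj G) u p v \<and> length p = n) \<longleftrightarrow>
    u \<in> pverts G \<and> (u, v) \<in> parcs G ^^ n"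
proof (induction n arbitrary: u)
  case 0
  show ?case
    by (auto simp: pre_digraph.awalk_def pre_digraph.cas.simps)
next
  case (Suc n)
  have "(\<exists>p. pre_digraph.awalk (with_proj G) u p v \<and> length p = Suc n) \<longleftrightarrow>
    (\<exists>w. u \<in> pverts G \<and> (u, w) \<in> parcs G \<and>
      (\<exists>p. pre_digraph.awalk (with_proj G) w p v \<and> length p = n))"
    (is "?L \<longleftrightarrow> ?R")
  proof
    assume ?L
    then obtain e p where "pre_digraph.awalk (with_proj G) u (e # p) v" "length p = n"
      by (auto simp: length_Suc_conv)
    then show ?R
      using assms
      by (cases e) (auto simp: pre_digraph.awalk_def pre_digraph.cas.simps)
  next
    assume ?R
    then obtain w p where "u \<in> pverts G" "(u, w) \<in> parcs G"
      "pre_digraph.awalk (with_proj G) w p v" "length p = n"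
      by blast
    then show ?L
      by (intro exI[of _ "(u, w) # p"])
        (auto simp: pre_digraph.awalk_def pre_digraph.cas.simps)
  qed
  then show ?case
    unfolding Suc.IH using assms by (blast intro: relpow_Suc_I2 elim: relpow_Suc_E2)
qed

lemma parcs_graph_power:
  assumes "parcs G \<subseteq> pverts G \<times> pverts G"
  shows "parcs (graph_power G t) = {(u, v). u \<in> pverts G \<and> (u, v) \<in> parcs G ^^ t}"
  unfolding graph_power_def using ex_awalk_iff_relpow[OF assms] by simp

lemma sym_relpow: "sym R \<Longrightarrow> sym (R ^^ n)"
  by (induction n) (simp_all add: sym_Id sym_conv_converse_eq converse_relcomp relpow_commute)

lemma relpow_trans: "(a, b) \<in> R ^^ m \<Longrightarrow> (b, c) \<in> R ^^ n \<Longrightarrow> (a, c) \<in> R ^^ (m + n)"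
  by (auto simp: relpow_add)

text \<open>The last arc can be traversed back and forth; the exponent \<open>Suc n\<close> ensures
  that there is one.\<close>

lemma relpow_lengthen:
  assumes "sym R" "(a, b) \<in> R ^^ Suc n"
  shows "(a, b) \<in> R ^^ (Suc n + 2 * m)"
proof (induction m)
  case 0
  show ?case using assms(2) by simp
next
  case (Suc m)
  obtain b' where b': "(b', b) \<in> R"
    using assms(2) by auto
  then have "(b, b') \<in> R"
    using assms(1) by (auto dest: symD)
  with b' have "(b, b) \<in> R ^^ 2"
    by (auto simp: numeral_2_eq_2)
  from relpow_trans[OF Suc.IH this] show ?case
    by (simp only: mult_Suc_right add.assoc add.commute[of 2])
qed

section \<open>Subdivisions\<close>

lemma subdiv_vertex_0: "subdiv_vertex t u v 0 = subdiv_vertex t u u 0"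
  by (auto simp: subdiv_vertex_def)

lemma subdiv_vertex_full: "subdiv_vertex t u v t = subdiv_vertex t v v 0"
  by (auto simp: subdiv_vertex_def)

lemma subdiv_vertex_in_pverts:
  assumes "pair_graph G" "(u, v) \<in> parcs G" "i \<le> t"
  shows "subdiv_vertex t u v i \<in> pverts (subdivide_edges t G)"
proof -
  interpret pair_graph G by fact
  have uv: "u \<in> pverts G" "v \<in> pverts G"
    using assms(2) in_arcsD1 in_arcsD2 by blast+
  consider "i = 0" | "i = t" | "0 < i" "i < t"
    using assms(3) by linarith
  then show ?thesis
    using uv assms(2) subdiv_vertex_0[of t u v] subdiv_vertex_full[of t u v]
    unfolding subdivide_edges_def by cases (simp, blast)+
qed

lemma parcs_subdivide_edges_subset:
  assumes "pair_graph G"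
  shows "parcs (subdivide_edges t G) \<subseteq>
    pverts (subdivide_edges t G) \<times> pverts (subdivide_edges t G)"
proof
  fix e assume "e \<in> parcs (subdivide_edges t G)"
  then obtain u v i j where "e = (subdiv_vertex t u v i, subdiv_vertex t u v j)"
    "(u, v) \<in> parcs G" "i \<le> t" "j \<le> t"
    unfolding subdivide_edges_def by auto
  then show "e \<in> pverts (subdivide_edges t G) \<times> pverts (subdivide_edges t G)"
    using subdiv_vertex_in_pverts[OF assms] by simp
qed

lemma sym_parcs_subdivide_edges: "sym (parcs (subdivide_edges t G))"
  unfolding sym_def subdivide_edges_def by simp blast

lemma subdiv_walk:
  assumes "(u, v) \<in> parcs G" "i \<le> t"
  shows "(subdiv_vertex t u u 0, subdiv_vertex t u v i) \<in> parcs (subdivide_edges t G) ^^ i"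
  using assms(2)
proof (induction i)
  case 0
  show ?case using subdiv_vertex_0[of t u v] by simp
next
  case (Suc i)
  have "(subdiv_vertex t u v i, subdiv_vertex t u v (Suc i)) \<in> parcs (subdivide_edges t G)"
    using assms(1) Suc.prems unfolding subdivide_edges_def by force
  with Suc show ?case
    by auto
qed

lemma chromatic_number_fractional_power_1_le:
  assumes "pair_graph G" "chromatic_number G = enat k"
  shows "chromatic_number (fractional_power G 0 0) \<le> enat k"
proof -
  obtain c where c: "proper_coloring G k c"
    using chromatic_number_le_iff[of G k] assms(2) by auto
  \<comment> \<open>For \<open>t = 1\<close> the subdivision vertices are indicator functions of
    vertices of \<open>G\<close>, so \<open>THE\<close> recovers the vertex.\<close>
  define d where "d f = c (THE u. f u = Suc 0)" for f :: "'a \<Rightarrow> nat"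
  have d0: "d (subdiv_vertex (Suc 0) u v 0) = c u" for u v
    unfolding d_def subdiv_vertex_def by auto
  have d1: "d (subdiv_vertex (Suc 0) u v (Suc 0)) = c v" for u v
    by (simp only: subdiv_vertex_full d0)
  have "proper_coloring (fractional_power G 0 0) k d"
    unfolding proper_coloring_def
  proof
    show "d ` pverts (fractional_power G 0 0) \<subseteq> {1..k}"
      using c d0
      by (auto simp: proper_coloring_def fractional_power_def graph_power_def subdivide_edges_def)
    have "d a \<noteq> d b" if "(a, b) \<in> parcs (fractional_power G 0 0)" for a b
    proof -
      from that have "(a, b) \<in> parcs (subdivide_edges 1 G)"
        unfolding fractional_power_def
        using parcs_graph_power[OF parcs_subdivide_edges_subset[OF assms(1)]] by simp
      then obtain u v where "(u, v) \<in> parcs G"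
        "a = subdiv_vertex 1 u v 0 \<and> b = subdiv_vertex 1 u v 1 \<or>
         a = subdiv_vertex 1 u v 1 \<and> b = subdiv_vertex 1 u v 0"
        unfolding subdivide_edges_def by (auto simp: le_Suc_eq)
      then show ?thesis
        using c d0 d1 unfolding proper_coloring_def by fastforce
    qed
    then show "\<forall>(a, b) \<in> parcs (fractional_power G 0 0). d a \<noteq> d b"
      by blast
  qed
  then show ?thesis
    using chromatic_number_le_iff by blast
qed

lemma fractional_power_coloring_imp_bipartite:
  assumes "pair_graph G" "colorful G" "chromatic_number G = enat k"
    and c: "proper_coloring (fractional_power G r s) k c" and "s < r"
  shows "bipartite G"
proof -
  interpret pair_graph G by fact
  let ?t = "2 * s + 1"
  let ?E = "parcs (subdivide_edges ?t G)"
  let ?P = "subdiv_vertex ?t"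
  let ?d = "\<lambda>v. c (?P v v 0)"
  have swap: "(v, u) \<in> parcs G" if "(u, v) \<in> parcs G" for u v
    using that by (rule arcs_symmetric)
  have symE: "sym (?E ^^ n)" for n
    by (intro sym_relpow sym_parcs_subdivide_edges)
  have separates: "c a \<noteq> c b" if ab: "(a, b) \<in> ?E ^^ n" and n: "n = ?t \<or> n = ?t + 2" for a b n
  proof -
    \<comment> \<open>Both \<open>n\<close> and \<open>2 * r + 1\<close> are odd, and
      \<open>s < r\<close> gives \<open>?t + 2 \<le> 2 * r + 1\<close>.\<close>
    obtain m where m: "2 * r + 1 = Suc (n - 1) + 2 * m"
    proof
      show "2 * r + 1 = Suc (n - 1) + 2 * ((2 * r + 1 - n) div 2)"
        using n \<open>s < r\<close> by auto
    qed
    from n have "Suc (n - 1) = n" by auto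
    with ab have "(a, b) \<in> ?E ^^ (2 * r + 1)"
      unfolding m by (intro relpow_lengthen sym_parcs_subdivide_edges) simp
    moreover from this obtain a' where "(a, a') \<in> ?E"
      using relpow_Suc_D2 by (metis Suc_eq_plus1)
    then have "a \<in> pverts (subdivide_edges ?t G)"
      using parcs_subdivide_edges_subset[OF assms(1)] by blast
    ultimately have "(a, b) \<in> parcs (fractional_power G r s)"
      unfolding fractional_power_def
      using parcs_graph_power[OF parcs_subdivide_edges_subset[OF assms(1)]] by simp
    then show ?thesis
      using c unfolding proper_coloring_def by blast
  qed
  have range: "c x \<in> {1..k}" if "x \<in> pverts (subdivide_edges ?t G)" for x
    using c that
    unfolding proper_coloring_def fractional_power_def graph_power_def by auto
  have flip: "?P u v i = ?P v u (?t - i)" if "i \<le> ?t" for u v i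
    by (rule subdiv_vertex_swap[OF that, symmetric])
  have proper: "proper_coloring G k ?d"
    unfolding proper_coloring_def
  proof (intro conjI)
    have "?P v v 0 \<in> pverts (subdivide_edges ?t G)" if "v \<in> pverts G" for v
      using that unfolding subdivide_edges_def by auto
    then show "?d ` pverts G \<subseteq> {1..k}"
      using range by blast
    have "?d u \<noteq> ?d v" if "(u, v) \<in> parcs G" for u v
      using separates[of "?P u u 0" "?P v v 0" ?t] subdiv_walk[OF that, of ?t ?t]
        subdiv_vertex_full[of ?t u v]
      by simp
    then show "\<forall>(u, v) \<in> parcs G. ?d u \<noteq> ?d v"
      by blast
  qed
  have "\<exists>H. induced_subgraph (with_proj H) (with_proj G) \<and> pverts H \<noteq> {} \<and>
      (\<forall>v \<in> pverts H. d ` closed_neighborhood H v = {1..k})" if "proper_coloring G k d" for d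
    using assms(2,3) that unfolding colorful_def by auto
  from this[OF proper] obtain H where ind: "induced_subgraph (with_proj H) (with_proj G)"
    and ne: "pverts H \<noteq> {}"
    and full: "\<And>v. v \<in> pverts H \<Longrightarrow> ?d ` closed_neighborhood H v = {1..k}"
    by blast
  have arcsH: "parcs H = {e \<in> parcs G. fst e \<in> pverts H \<and> snd e \<in> pverts H}"
    using ind unfolding induced_subgraph_def by auto
  have HG: "(u, v) \<in> parcs G" and Hv: "u \<in> pverts H" "v \<in> pverts H"
    and Hsym: "(v, u) \<in> parcs H" if "(u, v) \<in> parcs H" for u v
    using that swap unfolding arcsH by auto
  \<comment> \<open>The closed neighborhood of \<open>v\<close> in \<open>H\<close> shows every
    color, so a color missing from the neighbors can only be that of \<open>v\<close>.\<close>
  have forced: "q = ?d v"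
    if "v \<in> pverts H" "q \<in> {1..k}" "\<And>u. (v, u) \<in> parcs H \<Longrightarrow> q \<noteq> ?d u" for v q
  proof -
    from that(1,2) have "q \<in> ?d ` closed_neighborhood H v"
      using full by simp
    with that(3) show ?thesis
      unfolding closed_neighborhood_def by auto
  qed
  have even_pos: "c (?P v w (2 * i)) = ?d v" if "i \<le> s" "(v, w) \<in> parcs H" for i v w
    using that
  proof (induction i arbitrary: v w)
    case 0
    show ?case using subdiv_vertex_0[of ?t v w] by simp
  next
    case (Suc i)
    let ?x = "?P v w (2 * Suc i)"
    show ?case
    proof (rule forced)
      show "v \<in> pverts H" using Hv Suc.prems(2) by blast
      show "c ?x \<in> {1..k}"
        using Suc.prems HG by (intro range subdiv_vertex_in_pverts assms(1)) auto
    next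
      fix u assume vu: "(v, u) \<in> parcs H"
      \<comment> \<open>The walk goes back \<open>2 * i + 2\<close> steps to \<open>v\<close>, then
        \<open>?t - 2 * i\<close> steps towards \<open>u\<close>. It ends at distance
        \<open>2 * i\<close> from \<open>u\<close>, where the induction hypothesis for the arc
        \<open>(u, v)\<close> applies.\<close>
      have "(?x, ?P v v 0) \<in> ?E ^^ (2 * Suc i)"
        using Suc.prems HG by (intro symD[OF symE, OF subdiv_walk]) auto
      moreover have "(?P v v 0, ?P v u (?t - 2 * i)) \<in> ?E ^^ (?t - 2 * i)"
        using vu HG by (intro subdiv_walk) auto
      ultimately have "(?x, ?P v u (?t - 2 * i)) \<in> ?E ^^ (2 * Suc i + (?t - 2 * i))"
        by (rule relpow_trans)
      moreover have "2 * Suc i + (?t - 2 * i) = ?t + 2"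
        using Suc.prems(1) by simp
      ultimately have "c ?x \<noteq> c (?P v u (?t - 2 * i))"
        using separates by blast
      also have "?P v u (?t - 2 * i) = ?P u v (2 * i)"
        using flip[of "2 * i" u v] Suc.prems(1) by simp
      also have "c \<dots> = ?d u"
        using Suc.IH[of u v] Suc.prems(1) Hsym[OF vu] by simp
      finally show "c ?x \<noteq> ?d u" .
    qed
  qed
  \<comment> \<open>Since \<open>2 * s = ?t - 1\<close>, this is the last case of
    \<open>even_pos\<close>, read from the other end of the edge.\<close>
  have next_to: "c (?P w u 1) = ?d u" if "(w, u) \<in> parcs H" for w u
    using even_pos[of s u w] Hsym[OF that] flip[of 1 w u] by simp
  \<comment> \<open>By \<open>next_to\<close>, the colors of \<open>x\<close> and \<open>u\<close>
    reappear next to \<open>w\<close> and next to \<open>v\<close>. These two places are joined by a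
    walk along the whole edge \<open>wv\<close> with one extra step at each end, of length
    \<open>?t + 2\<close>.\<close>
  have mono: "?d x = ?d v" if vw: "(v, w) \<in> parcs H" and wx: "(w, x) \<in> parcs H" for v w x
  proof (rule forced)
    show "v \<in> pverts H" using Hv vw by blast
    show "?d x \<in> {1..k}"
      using full[OF Hv(2)[OF wx]] unfolding closed_neighborhood_def by blast
  next
    fix u assume vu: "(v, u) \<in> parcs H"
    have "(?P w x 1, ?P w w 0) \<in> ?E ^^ 1"
      using wx HG by (intro symD[OF symE, OF subdiv_walk]) auto
    moreover have "(?P w w 0, ?P v v 0) \<in> ?E ^^ ?t"
      using subdiv_walk[of w v G ?t ?t] HG[OF Hsym[OF vw]] subdiv_vertex_full[of ?t w v] by simp
    ultimately have "(?P w x 1, ?P v v 0) \<in> ?E ^^ (1 + ?t)"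
      by (rule relpow_trans)
    moreover have "(?P v v 0, ?P v u 1) \<in> ?E ^^ 1"
      using vu HG by (intro subdiv_walk) auto
    ultimately have "(?P w x 1, ?P v u 1) \<in> ?E ^^ (1 + ?t + 1)"
      by (rule relpow_trans)
    then have "c (?P w x 1) \<noteq> c (?P v u 1)"
      by (rule separates) simp
    then show "?d x \<noteq> ?d u"
      using next_to wx vu by simp
  qed
  obtain w where w: "w \<in> pverts H"
    using ne by blast
  \<comment> \<open>By \<open>mono\<close>, all neighbors of \<open>w\<close> in \<open>H\<close>
    share the color of any one of them; if there are none, \<open>q\<close> is arbitrary.\<close>
  have "\<exists>q. ?d ` closed_neighborhood H w \<subseteq> {?d w, q}"
  proof (cases "\<exists>v. (w, v) \<in> parcs H")
    case True
    then obtain v where v: "(w, v) \<in> parcs H"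
      by blast
    have "?d ` closed_neighborhood H w \<subseteq> {?d w, ?d v}"
      using mono[OF Hsym[OF v]] unfolding closed_neighborhood_def by blast
    then show ?thesis
      by blast
  next
    case False
    then show ?thesis
      unfolding closed_neighborhood_def by blast
  qed
  then obtain q where "{1..k} \<subseteq> {?d w, q}"
    unfolding full[OF w] by blast
  then have "card {1..k} \<le> card {?d w, q}"
    by (intro card_mono) auto
  also have "\<dots> \<le> 2"
    by (simp add: card_insert_if)
  finally have "k \<le> 2"
    by simp
  then show ?thesis
    using bipartite_if_proper_coloring_le_2[OF assms(1) proper] by blast
qed

theorem theorem3p5:
  fixes G :: "'a pair_pre_digraph"
  assumes "pair_graph G"
    and "\<not> bipartite G"
    and "colorful G"
  shows "theta G = 1"
  unfolding theta_def
proof (rule cSup_eq_maximum)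
  obtain k where k: "chromatic_number G = enat k"
    using assms(3) unfolding colorful_def by blast
  \<comment> \<open>The maximum 1 is attained at \<open>r = s = 0\<close>.\<close>
  have "ereal 1 < ereal_of_enat 2"
    by (simp add: numeral_eq_enat)
  also have "\<dots> \<le> ereal_of_enat (odd_girth G)"
    using odd_girth_ge_2[OF assms(1)] by simp
  finally show "1 \<in> {real (2 * r + 1) / real (2 * s + 1) | r s.
     chromatic_number (fractional_power G r s) \<le> chromatic_number G \<and>
     ereal (real (2 * r + 1) / real (2 * s + 1)) < ereal_of_enat (odd_girth G)}"
    using chromatic_number_fractional_power_1_le[OF assms(1) k] k
    by (intro CollectI exI[of _ 0]) simp
  fix x assume "x \<in> {real (2 * r + 1) / real (2 * s + 1) | r s.
     chromatic_number (fractional_power G r s) \<le> chromatic_number G \<and>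
     ereal (real (2 * r + 1) / real (2 * s + 1)) < ereal_of_enat (odd_girth G)}"
  then obtain r s where x: "x = real (2 * r + 1) / real (2 * s + 1)"
    and "chromatic_number (fractional_power G r s) \<le> enat k"
    using k by auto
  then obtain c where "proper_coloring (fractional_power G r s) k c"
    using chromatic_number_le_iff by blast
  then have "\<not> s < r"
    using fractional_power_coloring_imp_bipartite[OF assms(1,3) k] assms(2) by blast
  then show "x \<le> 1"
    unfolding x by simp
qed

end
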